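(* If $G$ is a connected graph of order at least $3$ such that $$|N_G(u)\cap N_G(v)\cap N_G(w)|>|N_G(u)\setminus (N_G[v]\cup N_G[w])|$$ for every induced path $vuw$ of order $3$ in $G$ (that is, for all distinct vertices $u,v,w$ with $u$ adjacent to both $v$ and $w$, and $v$ not adjacent to $w$), then $G$ is fully cycle extendable.
   Context: All graphs are finite, simple, and undirected. $n(G)$ is the order of $G$; $N_G(u)$ is the (open) neighborhood of $u$ in $G$ and $N_G[u]=N_G(u)\cup\{u\}$ its closed neighborhood. A cycle $C$ in $G$ is extendable if $G$ contains a cycle $C'$ of order $n(C)+1$ with $V(C)\subseteq V(C')$. $G$ is fully cycle extendable if every vertex of $G$ lies on a triangle and every cycle in $G$ of order less than $n(G)$ is extendable. *)

theory Defs
  imports "Graph_Theory.Digraph_Component"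
begin

(* Finite simple undirected graphs are the library's pair_graph: a finite vertex set with a
   symmetric irreflexive arc relation, each edge uv being the two arcs (u,v) and (v,u). *)

definition nbhd :: "'a pair_pre_digraph \<Rightarrow> 'a \<Rightarrow> 'a set" where
  "nbhd G u = {v. (u, v) \<in> parcs G}"

definition closed_nbhd :: "'a pair_pre_digraph \<Rightarrow> 'a \<Rightarrow> 'a set" where
  "closed_nbhd G u = insert u (nbhd G u)"

(* A cycle is given by the list of its arcs in traversal order. In a symmetric digraph
   u,v,u is a directed cycle too; the length bound excludes it. *)
definition graph_cycle :: "'a pair_pre_digraph \<Rightarrow> ('a \<times> 'a) awalk \<Rightarrow> bool" where
  "graph_cycle G C \<longleftrightarrow> pre_digraph.cycle (with_proj G) C \<and> 3 \<le> length C"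

(* Each vertex of a cycle is the tail of exactly one of its arcs. *)
definition cycle_verts :: "('a \<times> 'a) awalk \<Rightarrow> 'a set" where
  "cycle_verts C = fst ` set C"

definition cycle_order :: "('a \<times> 'a) awalk \<Rightarrow> nat" where
  "cycle_order C = card (cycle_verts C)"

definition extendable :: "'a pair_pre_digraph \<Rightarrow> ('a \<times> 'a) awalk \<Rightarrow> bool" where
  "extendable G C \<longleftrightarrow>
     (\<exists>C'. graph_cycle G C' \<and> cycle_order C' = cycle_order C + 1 \<and> cycle_verts C \<subseteq> cycle_verts C')"

definition fully_cycle_extendable :: "'a pair_pre_digraph \<Rightarrow> bool" where
  "fully_cycle_extendable G \<longleftrightarrow>
     (\<forall>x \<in> pverts G. \<exists>T. graph_cycle G T \<and> cycle_order T = 3 \<and> x \<in> cycle_verts T) \<and>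
     (\<forall>C. graph_cycle G C \<and> cycle_order C < card (pverts G) \<longrightarrow> extendable G C)"

end

(* Suppose a cycle C misses a vertex x that has a neighbor on C, let W be the set of neighbors of x
   on C, and write w+ for the successor of w on C.  If C cannot be extended then x is adjacent to
   no w+, the set W+ = {w+ | w in W} is independent, and every common neighbor of w and w+ lies on
   C.  Hence, for w in W, all neighbors of w in W+ other than w+ are counted on the right of the
   hypothesis for the induced path x w w+, and everything counted on its left is a neighbor of w+
   in W other than w.  So w has fewer neighbors in W+ than w+ has in W.  Summed over w in W,
   this says that the number of edges between W and W+ is less than itself. *)
theory Submission
  imports Defs
begin

section \<open>Cycles as vertex lists\<close>

text \<open>Vertex lists replace arc lists because the extensions below cut, reverse and splice the
  cycle; on arcs, reversal would also have to flip every pair.\<close>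

definition vertex_cycle :: "'a rel \<Rightarrow> 'a list \<Rightarrow> bool" where
  "vertex_cycle E xs \<longleftrightarrow> distinct xs \<and> 3 \<le> length xs \<and>
     successively (\<lambda>a b. (a, b) \<in> E) xs \<and> (last xs, hd xs) \<in> E"

text \<open>The appended \<open>xs\<close> handles the wrap-around: if \<open>w\<close> is the last
  entry, \<open>tl\<close> leaves nothing and the head of \<open>xs\<close> is returned.\<close>

definition cyclic_succ :: "'a list \<Rightarrow> 'a \<Rightarrow> 'a" where
  "cyclic_succ xs w = hd (tl (dropWhile (\<lambda>y. y \<noteq> w) xs) @ xs)"

lemma vertex_cycle_swap:
  assumes "vertex_cycle E (p @ q)"
  shows "vertex_cycle E (q @ p)"
  using assms
  by (cases "p = []"; cases "q = []") (auto simp: vertex_cycle_def successively_append_iff)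

lemma cyclic_succ_append:
  assumes "w \<notin> set p"
  shows "cyclic_succ (p @ w # q) w = hd (q @ p @ [w])"
proof -
  have "dropWhile (\<lambda>y. y \<noteq> w) (p @ w # q) = w # q"
    using assms by (induction p) auto
  then show ?thesis by (cases q; cases p) (auto simp: cyclic_succ_def)
qed

text \<open>Cutting the cycle right after \<open>w\<close> turns it into a path from the successor
  of \<open>w\<close> to \<open>w\<close>, so that inserting after \<open>w\<close> becomes a
  cons.\<close>

lemma cyclic_succ_rotation:
  assumes "distinct xs" "w \<in> set xs"
  obtains p q ys where "xs = p @ q" "q @ p = ys" "ys \<noteq> []" "hd ys = cyclic_succ xs w" "last ys = w"
proof -
  from split_list[OF assms(2)] obtain p q where xs: "xs = p @ w # q" by blast
  with assms(1) have "w \<notin> set p" by auto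
  with xs have "cyclic_succ xs w = hd (q @ p @ [w])"
    by (simp add: cyclic_succ_append)
  then show thesis using that[of "p @ [w]" q "q @ p @ [w]"] xs by simp
qed

lemma cyclic_succ_in_set:
  assumes "distinct xs" "w \<in> set xs"
  shows "cyclic_succ xs w \<in> set xs"
proof -
  obtain p q ys where "xs = p @ q" "q @ p = ys" "ys \<noteq> []" "hd ys = cyclic_succ xs w"
    using cyclic_succ_rotation[OF assms] by metis
  then show ?thesis using hd_in_set[of ys] by auto
qed

text \<open>Cutting after both \<open>w\<close> and \<open>w'\<close> leaves two paths:
  \<open>a\<close> from w+ to w' and \<open>b\<close> from w'+ to w. The wrap-around of
  \<open>xs\<close> falls inside \<open>b\<close> if w' comes after w in the list, and inside
  \<open>a\<close> otherwise.\<close>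

lemma cyclic_succ_split:
  assumes "distinct xs" "w \<in> set xs" "w' \<in> set xs" "w \<noteq> w'"
  obtains p q a b where "xs = p @ q" "q @ p = a @ b" "a \<noteq> []" "b \<noteq> []"
    "hd a = cyclic_succ xs w" "last a = w'" "hd b = cyclic_succ xs w'" "last b = w"
proof -
  from split_list[OF assms(2)] obtain p q where xs: "xs = p @ w # q" by blast
  have w: "cyclic_succ xs w = hd (q @ p @ [w])"
    using assms(1) xs by (auto intro: cyclic_succ_append)
  from assms xs consider "w' \<in> set q" | "w' \<in> set p" by auto
  then show thesis
  proof cases
    case 1
    then obtain q1 q2 where q: "q = q1 @ w' # q2" by (meson split_list)
    have "cyclic_succ xs w' = hd (q2 @ (p @ w # q1) @ [w'])"
      using assms(1) xs q cyclic_succ_append[of w' "p @ w # q1" q2] by auto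
    then show thesis
      using that[of "p @ [w]" q "q1 @ [w']" "q2 @ p @ [w]"] xs q w
      by (simp add: hd_append)
  next
    case 2
    then obtain p1 p2 where p: "p = p1 @ w' # p2" by (meson split_list)
    have "cyclic_succ xs w' = hd ((p2 @ w # q) @ p1 @ [w'])"
      using assms(1) xs p cyclic_succ_append[of w' p1 "p2 @ w # q"] by auto
    then show thesis
      using that[of "p @ [w]" q "q @ p1 @ [w']" "p2 @ [w]"] xs p w
      by (simp add: hd_append)
  qed
qed

lemma inj_on_cyclic_succ:
  assumes "distinct xs"
  shows "inj_on (cyclic_succ xs) (set xs)"
proof (rule inj_onI, rule ccontr)
  fix w w' assume *: "w \<in> set xs" "w' \<in> set xs" "cyclic_succ xs w = cyclic_succ xs w'" "w \<noteq> w'"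
  obtain p q a b where "xs = p @ q" "q @ p = a @ b" "a \<noteq> []" "b \<noteq> []"
    "hd a = cyclic_succ xs w" "hd b = cyclic_succ xs w'"
    using cyclic_succ_split[OF assms *(1,2,4)] by metis
  moreover from this(1,2) have "distinct (a @ b)" using assms
    by (metis distinct_append inf_commute)
  ultimately show False using *(3) by (metis disjoint_iff distinct_append hd_in_set)
qed

lemma vertex_cycle_succ:
  assumes "vertex_cycle E xs" "w \<in> set xs"
  shows "(w, cyclic_succ xs w) \<in> E"
proof -
  obtain p q ys where "xs = p @ q" "q @ p = ys" "hd ys = cyclic_succ xs w" "last ys = w"
    using cyclic_succ_rotation assms unfolding vertex_cycle_def by metis
  then show ?thesis using assms(1) vertex_cycle_swap[of E p q] by (simp add: vertex_cycle_def)
qed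

lemma vertex_cycle_insert:
  assumes "vertex_cycle E xs" "w \<in> set xs" "x \<notin> set xs" "(w, x) \<in> E" "(x, cyclic_succ xs w) \<in> E"
  shows "\<exists>ys. vertex_cycle E ys \<and> set ys = insert x (set xs)"
proof -
  obtain p q ys where ys: "xs = p @ q" "q @ p = ys" "ys \<noteq> []" "hd ys = cyclic_succ xs w" "last ys = w"
    using cyclic_succ_rotation assms(1,2) unfolding vertex_cycle_def by metis
  then have "vertex_cycle E ys" using assms(1) vertex_cycle_swap by metis
  moreover have "set ys = set xs" using ys by auto
  ultimately show ?thesis using assms ys
    by (intro exI[of _ "x # ys"]) (auto simp: vertex_cycle_def successively_Cons)
qed

text \<open>The classical crossover: go from x to w', back along \<open>a\<close> to w+, over the
  chord to w'+, along \<open>b\<close> to w, and return to x.\<close>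

lemma vertex_cycle_cross:
  assumes "sym E" "vertex_cycle E xs" "w \<in> set xs" "w' \<in> set xs" "w \<noteq> w'" "x \<notin> set xs"
    and "(w, x) \<in> E" "(w', x) \<in> E" "(cyclic_succ xs w, cyclic_succ xs w') \<in> E"
  shows "\<exists>ys. vertex_cycle E ys \<and> set ys = insert x (set xs)"
proof -
  obtain p q a b where ab: "xs = p @ q" "q @ p = a @ b" "a \<noteq> []" "b \<noteq> []"
    "hd a = cyclic_succ xs w" "last a = w'" "hd b = cyclic_succ xs w'" "last b = w"
    using cyclic_succ_split assms(2-5) unfolding vertex_cycle_def by metis
  then have "vertex_cycle E (a @ b)" using assms(2) vertex_cycle_swap by metis
  moreover have set: "set (a @ b) = set xs" using ab by (metis set_append sup_commute)
  \<comment> \<open>Reversing \<open>a\<close> flips the relation between consecutive entries, which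
    symmetry undoes.\<close>
  moreover have "successively (\<lambda>u v. (v, u) \<in> E) zs = successively (\<lambda>u v. (u, v) \<in> E) zs" for zs
    using assms(1) by (intro arg_cong2[of _ _ _ _ successively] ext) (auto dest: symD)
  moreover have "(x, w') \<in> E" using assms(1,8) by (rule symD)
  ultimately show ?thesis using assms ab
    by (intro exI[of _ "x # rev a @ b"] conjI)
      (simp_all add: vertex_cycle_def successively_Cons successively_append_iff hd_append hd_rev
        last_rev)
qed

section \<open>Translation to arc lists\<close>

lemma cas_conv_successively:
  assumes "p \<noteq> []"
  shows "pcas u p v \<longleftrightarrow>
    fst (hd p) = u \<and> snd (last p) = v \<and> successively (\<lambda>e e'. snd e = fst e') p"
  using assms
proof (induction p arbitrary: u)
  case (Cons e p)
  show ?case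
  proof (cases "p = []")
    case False
    have "pcas u (e # p) v \<longleftrightarrow> fst e = u \<and> pcas (snd e) p v" by simp
    also have "\<dots> \<longleftrightarrow> fst (hd (e # p)) = u \<and> snd (last (e # p)) = v \<and>
        successively (\<lambda>e e'. snd e = fst e') (e # p)"
      unfolding Cons.IH[OF False] using False by (auto simp: successively_Cons)
    finally show ?thesis .
  qed auto
qed simp

lemma awalk_verts_conv_fst:
  assumes "pcas u p v"
  shows "pawalk_verts u p = map fst p @ [v]"
  using assms by (induction p arbitrary: u) auto

text \<open>The base vertex that the library quantifies over can only be the tail of the first arc.
  The vertex list of a closed walk is its tails followed by that base vertex, so dropping its first
  entry gives a rotation of the tails; this is why distinctness may be stated for the tails.\<close>

lemma graph_cycle_conv:
  "graph_cycle G C \<longleftrightarrow> 3 \<le> length C \<and> fst (hd C) \<in> pverts G \<and> set C \<subseteq> parcs G \<and>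
     successively (\<lambda>e e'. snd e = fst e') C \<and> snd (last C) = fst (hd C) \<and> distinct (map fst C)"
proof (cases C)
  case Nil
  then show ?thesis by (simp add: graph_cycle_def)
next
  case (Cons e D)
  have dist: "distinct (tl (pawalk_verts u C)) \<longleftrightarrow> distinct (map fst C)" if "pcas u C u" for u
    using that awalk_verts_conv_fst[OF that] cas_conv_successively[of C u u] Cons by auto
  have pcas: "pcas u C u \<longleftrightarrow> u = fst (hd C) \<and> snd (last C) = fst (hd C) \<and>
      successively (\<lambda>e e'. snd e = fst e') C" for u
    using Cons by (subst cas_conv_successively) auto
  have "pcas u C u \<and> distinct (tl (pawalk_verts u C)) \<longleftrightarrow>
      u = fst (hd C) \<and> snd (last C) = fst (hd C) \<and>
      successively (\<lambda>e e'. snd e = fst e') C \<and> distinct (map fst C)" for u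
    using dist[of u] pcas[of u] by argo
  moreover have "graph_cycle G C \<longleftrightarrow> 3 \<le> length C \<and>
      (\<exists>u. u \<in> pverts G \<and> set C \<subseteq> parcs G \<and> pcas u C u \<and> distinct (tl (pawalk_verts u C)))"
    using Cons by (auto simp: graph_cycle_def pre_digraph.cycle_def pre_digraph.awalk_def
        cas_with_proj_eq awalk_verts_with_proj_eq simp del: pcas.simps pawalk_verts.simps)
  ultimately show ?thesis by (simp only: ex_simps simp_thms) blast
qed

lemma vertex_cycle_of_graph_cycle:
  assumes "graph_cycle G C"
  shows "vertex_cycle (parcs G) (map fst C)"
proof -
  have C: "3 \<le> length C" "set C \<subseteq> parcs G" "successively (\<lambda>e e'. snd e = fst e') C"
    "snd (last C) = fst (hd C)" "distinct (map fst C)"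
    using assms by (auto simp: graph_cycle_conv)
  have "successively (\<lambda>e e'. (fst e, fst e') \<in> parcs G) C"
    by (rule successively_mono[OF C(3)]) (use C(2) in \<open>metis prod.collapse subsetD\<close>)
  moreover have "C \<noteq> []" using C(1) by auto
  moreover from this have "(fst (last C), fst (hd C)) \<in> parcs G"
    using C(2,4) by (metis last_in_set prod.collapse subsetD)
  ultimately show ?thesis using C
    by (simp add: vertex_cycle_def successively_map last_map hd_map)
qed

lemma graph_cycle_of_vertex_cycle:
  assumes "vertex_cycle (parcs G) xs" "set xs \<subseteq> pverts G"
  shows "\<exists>C. graph_cycle G C \<and> cycle_verts C = set xs"
proof (intro exI conjI)
  \<comment> \<open>Each vertex is paired with the next one, and the last with the first.\<close>
  let ?C = "zip xs (rotate1 xs)"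
  have fst: "map fst ?C = xs" by simp
  have len: "3 \<le> length xs" using assms(1) by (simp add: vertex_cycle_def)
  then have ne: "xs \<noteq> []" "?C \<noteq> []" by (auto simp flip: length_0_conv)
  have rot: "rotate1 xs ! i = (if Suc i < length xs then xs ! Suc i else hd xs)"
    if "i < length xs" for i
    using that ne by (cases "Suc i = length xs") (auto simp: nth_rotate1 hd_conv_nth)
  have nth: "?C ! i = (xs ! i, if Suc i < length xs then xs ! Suc i else hd xs)"
    if "i < length xs" for i
    using that rot by simp
  have "?C ! i \<in> parcs G" if "i < length xs" for i
  proof (cases "Suc i < length xs")
    case True
    then show ?thesis using assms(1) nth[OF that]
      by (simp add: vertex_cycle_def successively_conv_nth)
  next
    case False
    then have "i = length xs - 1" using that by simp
    then have "xs ! i = last xs" using ne by (simp add: last_conv_nth)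
    then show ?thesis using assms(1) nth[OF that] False by (simp add: vertex_cycle_def)
  qed
  then have "set ?C \<subseteq> parcs G" by (auto simp only: set_conv_nth length_zip length_rotate1 min.idem)
  moreover have "successively (\<lambda>e e'. snd e = fst e') ?C"
    by (auto simp: successively_conv_nth rot)
  moreover have "fst (hd ?C) = hd xs" using ne(2) fst by (metis hd_map)
  moreover have "snd (last ?C) = hd xs"
    using ne rot[of "length xs - 1"] by (simp add: last_conv_nth)
  ultimately show "graph_cycle G ?C"
    using assms len ne(1) fst by (auto simp: graph_cycle_conv vertex_cycle_def)
  show "cycle_verts ?C = set xs"
    using fst unfolding cycle_verts_def by (metis set_map)
qed

section \<open>The edge count\<close>

text \<open>A walk from inside \<open>S\<close> to outside must use an arc that leaves
  \<open>S\<close>.\<close>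

lemma connected_boundary_arc:
  assumes "pair_graph G" "connected (with_proj G)"
    and "u \<in> S" "u \<in> pverts G" "v \<in> pverts G" "v \<notin> S"
  obtains y z where "(y, z) \<in> parcs G" "y \<in> S" "z \<notin> S"
proof -
  interpret pair_graph G by (rule assms(1))
  have "u \<rightarrow>\<^sup>*\<^bsub>with_proj G\<^esub> v"
    using symmetric_connected_imp_strongly_connected assms(2,4,5) pair_sym_arcs by auto
  then have "\<exists>y z. (y, z) \<in> parcs G \<and> y \<in> S \<and> z \<notin> S"
    using assms(3,6) by (induction rule: converse_reachable_induct) auto
  then show thesis using that by blast
qed

locale local_ore_graph = pair_graph G for G :: "'a pair_pre_digraph" +
  assumes local_ore: "\<And>u v w. \<lbrakk>u \<noteq> v; u \<noteq> w; v \<noteq> w;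
            (u, v) \<in> parcs G; (u, w) \<in> parcs G; (v, w) \<notin> parcs G\<rbrakk>
          \<Longrightarrow> card (nbhd G u \<inter> nbhd G v \<inter> nbhd G w) >
              card (nbhd G u - (closed_nbhd G v \<union> closed_nbhd G w))"
begin

lemma arc_sym: "(u, v) \<in> parcs G \<Longrightarrow> (v, u) \<in> parcs G"
  using pair_sym_arcs by (auto simp: symmetric_def dest: symD)

lemma no_loop: "(u, u) \<notin> parcs G"
  using pair_no_loops by fastforce

lemma finite_nbhd: "finite (nbhd G u)"
  by (rule finite_subset[OF _ pair_finite_verts]) (auto simp: nbhd_def in_arcsD2)

text \<open>The right side of the local condition is at least 0, so the left side counts a nonempty
  set. This serves the search for triangles.\<close>

lemma path_common_nbhd:
  assumes "(u, v) \<in> parcs G" "(u, w) \<in> parcs G" "v \<noteq> w" "(v, w) \<notin> parcs G"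
  obtains y where "(u, y) \<in> parcs G" "(v, y) \<in> parcs G" "(w, y) \<in> parcs G"
proof -
  have "card (nbhd G u \<inter> nbhd G v \<inter> nbhd G w) > 0"
    using local_ore[of u v w] assms no_loop by (metis gr_zeroI not_less_zero)
  then obtain y where "y \<in> nbhd G u \<inter> nbhd G v \<inter> nbhd G w"
    by (metis card.empty ex_in_conv less_irrefl)
  then show thesis using that by (auto simp: nbhd_def)
qed

text \<open>The added vertex may differ from \<open>x\<close>: an outside common neighbor of w and
  w+ would serve as well. Hence the contradiction hypothesis \<open>nonext\<close> ranges over all
  vertices off the cycle.\<close>

lemma vertex_cycle_extends:
  assumes cyc: "vertex_cycle (parcs G) xs" and x: "x \<notin> set xs"
    and u: "u \<in> set xs" "(u, x) \<in> parcs G"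
  shows "\<exists>y ys. y \<notin> set xs \<and> vertex_cycle (parcs G) ys \<and> set ys = insert y (set xs)"
proof (rule ccontr)
  assume "\<not> ?thesis"
  then have nonext: "\<not> (\<exists>ys. vertex_cycle (parcs G) ys \<and> set ys = insert y (set xs))"
    if "y \<notin> set xs" for y using that by blast
  define W where "W = {w \<in> set xs. (w, x) \<in> parcs G}"
  define s where "s = cyclic_succ xs"
  have dist: "distinct xs" using cyc by (simp add: vertex_cycle_def)
  have fin: "finite W" by (simp add: W_def)
  have inj: "inj_on s W"
    using inj_on_subset[OF inj_on_cyclic_succ[OF dist]] by (auto simp: W_def s_def)
  have s_in: "s w \<in> set xs" and s_arc: "(w, s w) \<in> parcs G" and s_x: "(x, s w) \<notin> parcs G"
    if "w \<in> W" for w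
    using that cyclic_succ_in_set[OF dist] vertex_cycle_succ[OF cyc]
      vertex_cycle_insert[OF cyc _ x] nonext[OF x]
    by (auto simp: W_def s_def)
  have s_indep: "(s w, s w') \<notin> parcs G" if "w \<in> W" "w' \<in> W" for w w'
    using that vertex_cycle_cross[OF _ cyc, of w w' x] x nonext[OF x] no_loop arc_sym
    by (cases "w = w'") (auto simp: W_def s_def sym_def)
  have less: "card {t \<in> s ` W. (w, t) \<in> parcs G} < card {w' \<in> W. (w', s w) \<in> parcs G}"
    if w: "w \<in> W" for w
  proof -
    let ?A = "{t \<in> s ` W. (w, t) \<in> parcs G}" and ?B = "{w' \<in> W. (w', s w) \<in> parcs G}"
    have wx: "w \<in> set xs" "(w, x) \<in> parcs G" using w by (auto simp: W_def)
    have left: "nbhd G w \<inter> nbhd G x \<inter> nbhd G (s w) \<subseteq> ?B - {w}"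
    proof
      fix y assume "y \<in> nbhd G w \<inter> nbhd G x \<inter> nbhd G (s w)"
      then have y: "(w, y) \<in> parcs G" "(y, x) \<in> parcs G" "(y, s w) \<in> parcs G"
        using arc_sym by (auto simp: nbhd_def)
      then have "y \<in> set xs" using vertex_cycle_insert[OF cyc wx(1)] nonext by (auto simp: s_def)
      then show "y \<in> ?B - {w}" using y no_loop by (auto simp: W_def)
    qed
    \<comment> \<open>Such a t lies on the cycle, hence differs from x; it is not adjacent to x by
      \<open>s_x\<close>, nor to \<open>s w\<close> by \<open>s_indep\<close>.\<close>
    have right: "?A - {s w} \<subseteq> nbhd G w - (closed_nbhd G x \<union> closed_nbhd G (s w))"
      using s_x s_indep w s_in x by (auto simp: closed_nbhd_def nbhd_def)
    have "card (?A - {s w}) \<le> card (nbhd G w - (closed_nbhd G x \<union> closed_nbhd G (s w)))"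
      by (rule card_mono[OF _ right]) (simp add: finite_nbhd)
    also have "\<dots> < card (nbhd G w \<inter> nbhd G x \<inter> nbhd G (s w))"
      using local_ore[of w x "s w"] wx s_in[OF w] s_arc[OF w] s_x[OF w] x no_loop by metis
    also have "\<dots> \<le> card (?B - {w})"
      by (rule card_mono[OF _ left]) (simp add: fin)
    finally have *: "card (?A - {s w}) < card (?B - {w})" .
    \<comment> \<open>\<open>s w\<close> is in \<open>?A\<close> and \<open>w\<close> is in
      \<open>?B\<close>, both because of the arc from w to \<open>s w\<close>; so each removal
      lowers the cardinality by exactly one.\<close>
    have "card ?A = Suc (card (?A - {s w}))" "card ?B = Suc (card (?B - {w}))"
      using w s_arc[OF w] fin by (auto simp only: intro!: card.remove) auto
    with * show ?thesis by linarith
  qed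
  have "(\<Sum>w\<in>W. card {t \<in> s ` W. (w, t) \<in> parcs G}) =
      (\<Sum>t\<in>s ` W. card {w \<in> W. (w, t) \<in> parcs G})"
    using fin by (intro sum_multicount_gen) auto
  also have "\<dots> = (\<Sum>w\<in>W. card {w' \<in> W. (w', s w) \<in> parcs G})"
    by (simp add: sum.reindex[OF inj])
  \<comment> \<open>The sum is strictly smaller because \<open>W\<close> contains \<open>u\<close>
    and so is nonempty.\<close>
  moreover have "(\<Sum>w\<in>W. card {t \<in> s ` W. (w, t) \<in> parcs G}) <
      (\<Sum>w\<in>W. card {w' \<in> W. (w', s w) \<in> parcs G})"
    using fin u less by (intro sum_strict_mono) (auto simp: W_def)
  ultimately show False by simp
qed

section \<open>The two halves of full cycle extendability\<close>

lemma graph_cycle_extendable: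
  assumes "connected (with_proj G)" "graph_cycle G C" "cycle_order C < card (pverts G)"
  shows "extendable G C"
proof -
  let ?xs = "map fst C"
  have cyc: "vertex_cycle (parcs G) ?xs" using assms(2) by (rule vertex_cycle_of_graph_cycle)
  have verts: "cycle_verts C = set ?xs" by (simp add: cycle_verts_def)
  have sub: "set ?xs \<subseteq> pverts G" using assms(2) in_arcsD1 by (fastforce simp: graph_cycle_conv)
  have "card (set ?xs) \<noteq> card (pverts G)"
    using assms(3) unfolding cycle_order_def verts by simp
  then obtain v where v: "v \<in> pverts G" "v \<notin> set ?xs"
    using sub by (metis subsetI subset_antisym)
  have "hd ?xs \<in> set ?xs" using cyc by (intro hd_in_set) (auto simp: vertex_cycle_def)
  then obtain y z where "(y, z) \<in> parcs G" "y \<in> set ?xs" "z \<notin> set ?xs"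
    using connected_boundary_arc[OF pair_graph_axioms assms(1) _ _ v] sub by blast
  then obtain t ys where ys: "t \<notin> set ?xs" "vertex_cycle (parcs G) ys" "set ys = insert t (set ?xs)"
    using vertex_cycle_extends[OF cyc] by blast
  \<comment> \<open>Every entry of \<open>ys\<close>, including the new one, is the tail of an
    arc.\<close>
  have "a \<in> pverts G" if "a \<in> set ys" for a
    using vertex_cycle_succ[OF ys(2) that] by (rule in_arcsD1)
  then obtain C' where C': "graph_cycle G C'" "cycle_verts C' = set ys"
    using graph_cycle_of_vertex_cycle[OF ys(2)] by blast
  have "card (set ys) = card (set ?xs) + 1" "set ?xs \<subseteq> set ys"
    unfolding ys(3) using ys(1) by auto
  then show ?thesis
    unfolding extendable_def cycle_order_def verts using C' by metis
qed

text \<open>An edge xu and an arc leaving {x, u} form a path of order 3 centered at x or u. If its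
  ends are adjacent, it closes to a triangle; otherwise a common neighbor of its three vertices
  forms a triangle with x and u.\<close>

lemma ex_triangle:
  assumes "connected (with_proj G)" "card (pverts G) \<ge> 3" "x \<in> pverts G"
  shows "\<exists>T. graph_cycle G T \<and> cycle_order T = 3 \<and> x \<in> cycle_verts T"
proof -
  have ex_other: "\<exists>v \<in> pverts G. v \<notin> S" if "finite S" "card S < 3" for S
    using card_mono[OF that(1), of "pverts G"] that(2) assms(2) by force
  obtain u where u: "(x, u) \<in> parcs G"
    using ex_other[of "{x}"] connected_boundary_arc[OF pair_graph_axioms assms(1), of x "{x}"] assms(3)
    by auto
  have "card {x, u} < 3" by (simp add: card_insert_if)
  then obtain v where "v \<in> pverts G" "v \<notin> {x, u}" using ex_other[of "{x, u}"] by auto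
  then obtain y z where yz: "(y, z) \<in> parcs G" "y \<in> {x, u}" "z \<notin> {x, u}"
    using connected_boundary_arc[OF pair_graph_axioms assms(1), of x "{x, u}"] assms(3) by auto
  have "\<exists>b c. (x, b) \<in> parcs G \<and> (b, c) \<in> parcs G \<and> (c, x) \<in> parcs G"
  proof (cases "y = x")
    case True
    then show ?thesis
      using u yz path_common_nbhd[of x u z] arc_sym by (metis insertCI)
  next
    case False
    then show ?thesis
      using u yz path_common_nbhd[of u x z] arc_sym by (metis insertE singletonD insertCI)
  qed
  then obtain b c where bc: "(x, b) \<in> parcs G" "(b, c) \<in> parcs G" "(c, x) \<in> parcs G" by blast
  then have "x \<noteq> b" "b \<noteq> c" "c \<noteq> x" using no_loop by auto
  with bc have "vertex_cycle (parcs G) [x, b, c]" by (simp add: vertex_cycle_def)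
  then obtain T where "graph_cycle G T" "cycle_verts T = {x, b, c}"
    using graph_cycle_of_vertex_cycle[of G "[x, b, c]"] bc in_arcsD1 by auto
  with \<open>x \<noteq> b\<close> \<open>b \<noteq> c\<close> \<open>c \<noteq> x\<close> show ?thesis by (auto simp: cycle_order_def)
qed

end

theorem theorem9:
  fixes G :: "'a pair_pre_digraph"
  assumes "pair_graph G"
    and "connected (with_proj G)"
    and "card (pverts G) \<ge> 3"
    and "\<And>u v w. \<lbrakk>u \<in> pverts G; v \<in> pverts G; w \<in> pverts G;
            u \<noteq> v; u \<noteq> w; v \<noteq> w;
            (u, v) \<in> parcs G; (u, w) \<in> parcs G; (v, w) \<notin> parcs G\<rbrakk>
          \<Longrightarrow> card (nbhd G u \<inter> nbhd G v \<inter> nbhd G w) >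
              card (nbhd G u - (closed_nbhd G v \<union> closed_nbhd G w))"
  shows "fully_cycle_extendable G"
proof -
  interpret pair_graph G by (rule assms(1))
  interpret local_ore_graph G
    \<comment> \<open>Ends of arcs are vertices, which supplies the membership premises of the
      hypothesis.\<close>
    by unfold_locales (use assms(4) in_arcsD1 in_arcsD2 in blast)
  show ?thesis
    unfolding fully_cycle_extendable_def
    using ex_triangle graph_cycle_extendable assms(2,3) by blast
qed

end
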